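(* Let $c$ be a positive real number and let $l_1,l_2$ be two distinct lines in the Euclidean plane $\mathbb{R}^2$ intersecting at a point $C$, with non-obtuse angle $\theta$ between them. Then the ellipse with constant $c$ and eccentrices $l_1$ and $l_2$ is the ellipse with center $C$, semi-major axis $a=\frac{\sqrt{c}}{\sqrt{1-\cos\theta}}$ and semi-minor axis $b=\frac{\sqrt{c}}{\sqrt{1+\cos\theta}}$, such that the major axis of the ellipse is the angle bisector of $\theta$. In addition, for $\lambda_1=\lambda_2=1$ and linearly independent unit vectors $v_1$ and $v_2$, each of which is perpendicular to one of the eccentrices $l_1,l_2$, this ellipse is the $(v_1,v_2)$-Euclidean circle with center $C$ and radius $\sqrt{c}$, and $\sqrt{c}$ is the Euclidean distance from an intersection point of one eccentrix and the ellipse to the other eccentrix.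
   Context: Let $d_E(P,l)$ denote the Euclidean distance from a point $P$ to a line $l$. For two distinct intersecting lines $l_1,l_2$ and $c>0$, the ellipse with constant $c$ and eccentrices $l_1,l_2$ is the set of all points $P\in\mathbb{R}^2$ with $(d_E(P,l_1))^2+(d_E(P,l_2))^2=c$. Ellipses (in the usual Euclidean sense) include Euclidean circles; for a Euclidean circle any line through the center may be taken as its major axis. The center of an ellipse is its center of symmetry. The angle bisector of $\theta$ is the line through $C$ bisecting the non-obtuse angle between $l_1$ and $l_2$. Write $v_i=(v_{i1},v_{i2})$. For $\lambda_1=\lambda_2=1$ the $(v_1,v_2)$-Euclidean distance between $P_1=(x_1,y_1)$ and $P_2=(x_2,y_2)$ is $$d_{E(v_1,v_2)}(P_1,P_2)=\left[(v_{11}(x_1-x_2)+v_{12}(y_1-y_2))^2+(v_{21}(x_1-x_2)+v_{22}(y_1-y_2))^2\right]^{1/2},$$ and the $(v_1,v_2)$-Euclidean circle with center $C$ and radius $r>0$ is $\{P\in\mathbb{R}^2: d_{E(v_1,v_2)}(C,P)=r\}$. *)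

theory Defs
  imports "HOL-Analysis.Analysis"
begin

definition is_line :: "(real^2) set \<Rightarrow> bool" where
  "is_line l \<longleftrightarrow> affine l \<and> aff_dim l = 1"

definition eccentrix_ellipse :: "real \<Rightarrow> (real^2) set \<Rightarrow> (real^2) set \<Rightarrow> (real^2) set" where
  "eccentrix_ellipse c l1 l2 = {P. (infdist P l1)\<^sup>2 + (infdist P l2)\<^sup>2 = c}"

text \<open>The unoriented angle in [0, pi] at the vertex \<open>Q\<close>; meaningful only for \<open>P \<noteq> Q\<close> and \<open>R \<noteq> Q\<close>.\<close>

definition vertex_angle :: "real^2 \<Rightarrow> real^2 \<Rightarrow> real^2 \<Rightarrow> real" where
  "vertex_angle P Q R = arccos (((P - Q) \<bullet> (R - Q)) / (norm (P - Q) * norm (R - Q)))"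

definition nonobtuse_angle_between ::
    "(real^2) set \<Rightarrow> (real^2) set \<Rightarrow> real^2 \<Rightarrow> real \<Rightarrow> bool" where
  "nonobtuse_angle_between l1 l2 C \<theta> \<longleftrightarrow>
     \<theta> \<le> pi / 2 \<and> (\<exists>A \<in> l1 - {C}. \<exists>B \<in> l2 - {C}. vertex_angle A C B = \<theta>)"

text \<open>The angle bisector is a predicate on lines because it is unique only for
  non-perpendicular lines; two perpendicular lines have two bisectors.\<close>

definition is_angle_bisector ::
    "(real^2) set \<Rightarrow> (real^2) set \<Rightarrow> real^2 \<Rightarrow> (real^2) set \<Rightarrow> bool" where
  "is_angle_bisector l1 l2 C m \<longleftrightarrow>
     (\<exists>A \<in> l1 - {C}. \<exists>B \<in> l2 - {C}. \<exists>D. D \<noteq> C \<and>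
        vertex_angle A C B \<le> pi / 2 \<and>
        vertex_angle A C D = vertex_angle A C B / 2 \<and>
        vertex_angle D C B = vertex_angle A C B / 2 \<and>
        m = affine hull {C, D})"

text \<open>\<open>E\<close> is the ellipse with center \<open>C\<close>, semi-major axis \<open>a\<close>, semi-minor axis \<open>b\<close> and major
  axis the line \<open>m\<close>, given by its standard equation in an orthonormal frame at \<open>C\<close>. For
  \<open>a = b\<close> this is a circle, and then every line \<open>m\<close> through \<open>C\<close> is admitted.\<close>

definition is_ellipse ::
    "(real^2) set \<Rightarrow> real^2 \<Rightarrow> real \<Rightarrow> real \<Rightarrow> (real^2) set \<Rightarrow> bool" where
  "is_ellipse E C a b m \<longleftrightarrow> 0 < b \<and> b \<le> a \<and>
     (\<exists>e1 e2. norm e1 = 1 \<and> norm e2 = 1 \<and> orthogonal e1 e2 \<and>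
        m = affine hull {C, C + e1} \<and>
        E = {C + x *\<^sub>R e1 + y *\<^sub>R e2 | x y. x\<^sup>2 / a\<^sup>2 + y\<^sup>2 / b\<^sup>2 = 1})"

lemma is_ellipse_center_symmetric:
  assumes "is_ellipse E C a b m" "P \<in> E"
  shows "2 *\<^sub>R C - P \<in> E"
proof -
  from assms obtain e1 e2 where
    E: "E = {C + x *\<^sub>R e1 + y *\<^sub>R e2 | x y. x\<^sup>2 / a\<^sup>2 + y\<^sup>2 / b\<^sup>2 = 1}"
    unfolding is_ellipse_def by blast
  with assms(2) obtain x y where
    P: "P = C + x *\<^sub>R e1 + y *\<^sub>R e2" and xy: "x\<^sup>2 / a\<^sup>2 + y\<^sup>2 / b\<^sup>2 = 1"
    by blast
  have "2 *\<^sub>R C - P = C + (- x) *\<^sub>R e1 + (- y) *\<^sub>R e2"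
    unfolding P by (simp add: scaleR_2 algebra_simps)
  moreover have "(- x)\<^sup>2 / a\<^sup>2 + (- y)\<^sup>2 / b\<^sup>2 = 1"
    using xy by simp
  ultimately show ?thesis
    unfolding E by blast
qed

definition perpendicular_to_line :: "real^2 \<Rightarrow> (real^2) set \<Rightarrow> bool" where
  "perpendicular_to_line v l \<longleftrightarrow> (\<forall>P \<in> l. \<forall>Q \<in> l. orthogonal v (P - Q))"

text \<open>The \<open>(v1, v2)\<close>-Euclidean distance with both weights equal to 1.\<close>

definition v_euclidean_dist :: "real^2 \<Rightarrow> real^2 \<Rightarrow> real^2 \<Rightarrow> real^2 \<Rightarrow> real" where
  "v_euclidean_dist v1 v2 P1 P2 =
     sqrt ((v1 $ 1 * (P1 $ 1 - P2 $ 1) + v1 $ 2 * (P1 $ 2 - P2 $ 2))\<^sup>2 +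
           (v2 $ 1 * (P1 $ 1 - P2 $ 1) + v2 $ 2 * (P1 $ 2 - P2 $ 2))\<^sup>2)"

definition v_euclidean_circle :: "real^2 \<Rightarrow> real^2 \<Rightarrow> real^2 \<Rightarrow> real \<Rightarrow> (real^2) set" where
  "v_euclidean_circle v1 v2 C r = {P. v_euclidean_dist v1 v2 C P = r}"

end

theory Submission
  imports Defs
begin

text \<open>Let \<open>u1\<close>, \<open>u2\<close> be unit directions of the lines enclosing the angle \<open>\<theta>\<close> and put \<open>w = P - C\<close>.
  By Pythagoras the sum of the squared distances is \<open>2|w|\<^sup>2 - (w \<bullet> u1)\<^sup>2 - (w \<bullet> u2)\<^sup>2\<close>. This quadratic
  form is diagonal in the frame along \<open>u1 + u2\<close> and \<open>u1 - u2\<close>, with eigenvalues \<open>1 - cos \<theta>\<close> and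
  \<open>1 + cos \<theta>\<close>; and \<open>|w|\<^sup>2 - (w \<bullet> u)\<^sup>2 = (v \<bullet> w)\<^sup>2\<close> for a unit normal \<open>v\<close> of \<open>u\<close>, which gives the
  description as a circle of the \<open>(v1, v2)\<close>-distance.\<close>

section \<open>Lines through \<open>C\<close> and the squared distance to them\<close>

lemma line_eq_range_unit:
  assumes "is_line l" "C \<in> l" "A \<in> l" "A \<noteq> C"
  shows "l = range (\<lambda>t. C + t *\<^sub>R sgn (A - C))"
proof -
  have "affine hull {C, A} = l"
  proof (rule affine_dim_equal)
    show "affine hull {C, A} \<subseteq> l"
      using assms by (simp add: is_line_def hull_minimal)
    show "aff_dim (affine hull {C, A}) = aff_dim l"
      using assms by (simp add: is_line_def aff_dim_2)
  qed (use assms in \<open>auto simp: is_line_def\<close>)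
  then have l: "l = range (\<lambda>t. C + t *\<^sub>R (A - C))"
    using affine_hull_2_alt[of C A] by simp
  have "range (\<lambda>t. C + t *\<^sub>R (A - C)) \<subseteq> range (\<lambda>t. C + t *\<^sub>R sgn (A - C))"
  proof safe
    fix t
    have "C + t *\<^sub>R (A - C) = C + (t * norm (A - C)) *\<^sub>R sgn (A - C)"
      using assms by (simp add: sgn_div_norm)
    then show "C + t *\<^sub>R (A - C) \<in> range (\<lambda>t. C + t *\<^sub>R sgn (A - C))"
      by (rule range_eqI)
  qed
  moreover have "range (\<lambda>t. C + t *\<^sub>R sgn (A - C)) \<subseteq> range (\<lambda>t. C + t *\<^sub>R (A - C))"
  proof safe
    fix t
    have "C + t *\<^sub>R sgn (A - C) = C + (t / norm (A - C)) *\<^sub>R (A - C)"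
      by (simp add: sgn_div_norm divide_inverse)
    then show "C + t *\<^sub>R sgn (A - C) \<in> range (\<lambda>t. C + t *\<^sub>R (A - C))"
      by (rule range_eqI)
  qed
  ultimately show ?thesis
    unfolding l by (rule equalityI)
qed

text \<open>The minimum is attained at the foot of the perpendicular, the point with parameter
  \<open>w \<bullet> u\<close>. Subtracting the squared component of \<open>w\<close> along
  \<open>u\<close> from its squared length leaves the squared distance to that foot.\<close>

lemma infdist_line_power2:
  fixes u :: "'a::real_inner"
  assumes "norm u = 1"
  shows "(infdist P (range (\<lambda>t. C + t *\<^sub>R u)))\<^sup>2 = (norm (P - C))\<^sup>2 - ((P - C) \<bullet> u)\<^sup>2"
proof -
  define w where "w = P - C"
  define s where "s = (norm w)\<^sup>2 - (w \<bullet> u)\<^sup>2"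
  let ?l = "range (\<lambda>t. C + t *\<^sub>R u)"
  have uu: "u \<bullet> u = 1"
    using assms by (simp add: norm_eq_1)
  \<comment> \<open>Completing the square in \<open>t\<close>: only the second summand depends on
    \<open>t\<close>, and it vanishes at the foot.\<close>
  have d: "(dist P (C + t *\<^sub>R u))\<^sup>2 = s + (w \<bullet> u - t)\<^sup>2" for t
  proof -
    have "dist P (C + t *\<^sub>R u) = norm (w - t *\<^sub>R u)"
      by (simp add: dist_norm w_def algebra_simps)
    then show ?thesis
      unfolding s_def power2_norm_eq_inner \<open>dist P (C + t *\<^sub>R u) = norm (w - t *\<^sub>R u)\<close>
      by (simp add: inner_diff inner_commute uu power2_eq_square algebra_simps)
  qed
  have s0: "s = (dist P (C + (w \<bullet> u) *\<^sub>R u))\<^sup>2"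
    by (simp add: d)
  have "infdist P ?l \<le> dist P (C + (w \<bullet> u) *\<^sub>R u)"
    by (intro infdist_le) auto
  moreover have "dist P (C + (w \<bullet> u) *\<^sub>R u) \<le> infdist P ?l"
  proof -
    have "dist P (C + (w \<bullet> u) *\<^sub>R u) \<le> dist P (C + t *\<^sub>R u)" for t
      by (rule power2_le_imp_le) (simp_all add: d)
    then show ?thesis
      by (auto simp: infdist_def intro!: cINF_greatest)
  qed
  ultimately show ?thesis
    using s0 by (simp add: s_def w_def)
qed

section \<open>Orthonormal frames of the plane\<close>

lemma orthonormal_expansion_2:
  fixes e1 e2 w :: "real^2"
  assumes "norm e1 = 1" "norm e2 = 1" "e1 \<bullet> e2 = 0"
  shows "w = (w \<bullet> e1) *\<^sub>R e1 + (w \<bullet> e2) *\<^sub>R e2"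
proof -
  have ne: "e1 \<noteq> e2"
    using assms by (metis inner_eq_zero_iff norm_zero zero_neq_one)
  have "pairwise orthogonal {e1, e2}"
    using assms by (auto simp: pairwise_def orthogonal_def inner_commute)
  moreover have "0 \<notin> {e1, e2}"
    using assms by auto
  ultimately have "independent {e1, e2}"
    by (rule pairwise_orthogonal_independent)
  then have "dim {e1, e2} = 2"
    using ne by (simp add: dim_eq_card_independent)
  then have "span {e1, e2} = UNIV"
    using dim_eq_full[of "{e1, e2}"] by simp
  then have "(\<Sum>e\<in>{e1, e2}. (w \<bullet> e) *\<^sub>R e) = w"
    using assms \<open>pairwise orthogonal {e1, e2}\<close>
    by (intro orthonormal_basis_expand) auto
  then show ?thesis
    using ne by simp
qed

lemma inner_normal_power2:
  fixes u v w :: "real^2"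
  assumes "norm u = 1" "norm v = 1" "u \<bullet> v = 0"
  shows "(v \<bullet> w)\<^sup>2 = (norm w)\<^sup>2 - (w \<bullet> u)\<^sup>2"
proof -
  have "(norm w)\<^sup>2 = w \<bullet> ((w \<bullet> u) *\<^sub>R u + (w \<bullet> v) *\<^sub>R v)"
    using orthonormal_expansion_2[OF assms, of w] by (simp add: power2_norm_eq_inner)
  then show ?thesis
    by (simp add: inner_add_right power2_eq_square inner_commute)
qed

section \<open>Directions, angles and the existence of a bisector\<close>

lemma cos_vertex_angle:
  assumes "P \<noteq> Q" "R \<noteq> Q"
  shows "cos (vertex_angle P Q R) = sgn (P - Q) \<bullet> sgn (R - Q)"
proof -
  \<comment> \<open>Cauchy-Schwarz puts the inner product into [-1, 1], where \<open>cos\<close>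
    undoes \<open>arccos\<close>.\<close>
  have "\<bar>sgn (P - Q) \<bullet> sgn (R - Q)\<bar> \<le> 1"
    using Cauchy_Schwarz_ineq2[of "sgn (P - Q)" "sgn (R - Q)"] assms by (simp add: norm_sgn)
  moreover have "vertex_angle P Q R = arccos (sgn (P - Q) \<bullet> sgn (R - Q))"
    by (simp add: vertex_angle_def sgn_div_norm divide_inverse mult_ac)
  ultimately show ?thesis
    by (simp add: cos_arccos_abs)
qed

lemma vertex_angle_bounds:
  assumes "P \<noteq> Q" "R \<noteq> Q"
  shows "0 \<le> vertex_angle P Q R" "vertex_angle P Q R \<le> pi"
proof -
  have "\<bar>((P - Q) \<bullet> (R - Q)) / (norm (P - Q) * norm (R - Q))\<bar> \<le> 1"
    using Cauchy_Schwarz_ineq2[of "P - Q" "R - Q"] assms by (simp add: abs_mult)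
  then show "0 \<le> vertex_angle P Q R" "vertex_angle P Q R \<le> pi"
    unfolding vertex_angle_def abs_le_iff by (simp_all add: arccos_lbound arccos_ubound)
qed

text \<open>Different points of a line may witness its angles, so a unit direction is determined
  only up to sign.\<close>

lemma sgn_diff_on_line:
  fixes u :: "'a::real_normed_vector"
  assumes "A \<in> range (\<lambda>t. C + t *\<^sub>R u)" "A \<noteq> C" "norm u = 1"
  shows "sgn (A - C) = u \<or> sgn (A - C) = - u"
proof -
  obtain t where t: "A = C + t *\<^sub>R u"
    using assms(1) by blast
  with assms have "t \<noteq> 0" "sgn (A - C) = sgn t *\<^sub>R u"
    by (auto simp: sgn_scaleR sgn_div_norm[of u])
  then show ?thesis
    by (cases "t > 0") auto
qed

text \<open>This is the equality case of Cauchy-Schwarz: the part of \<open>u1\<close> orthogonal to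
  \<open>u2\<close> has squared norm \<open>1 - (u1 \<bullet> u2)\<^sup>2\<close>. If it vanishes,
  \<open>u1\<close> is \<open>u2\<close> or \<open>- u2\<close>, and the two lines coincide.\<close>

lemma inner_power2_less_1:
  fixes u1 u2 :: "'a::real_inner"
  assumes "norm u1 = 1" "norm u2 = 1"
    and "range (\<lambda>t. C + t *\<^sub>R u1) \<noteq> range (\<lambda>t. C + t *\<^sub>R u2)"
  shows "(u1 \<bullet> u2)\<^sup>2 < 1"
proof (rule ccontr)
  assume "\<not> (u1 \<bullet> u2)\<^sup>2 < 1"
  moreover have "(norm (u1 - (u1 \<bullet> u2) *\<^sub>R u2))\<^sup>2 = 1 - (u1 \<bullet> u2)\<^sup>2"
    unfolding power2_norm_eq_inner using assms(1,2)
    by (simp add: norm_eq_1 inner_diff inner_commute power2_eq_square)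
  ultimately have "(norm (u1 - (u1 \<bullet> u2) *\<^sub>R u2))\<^sup>2 \<le> 0"
    by simp
  then have "u1 - (u1 \<bullet> u2) *\<^sub>R u2 = 0"
    by simp
  then have u1: "u1 = (u1 \<bullet> u2) *\<^sub>R u2"
    by simp
  then have "norm u1 = \<bar>u1 \<bullet> u2\<bar> * norm u2"
    by (metis norm_scaleR)
  then have "u1 \<bullet> u2 = 1 \<or> u1 \<bullet> u2 = - 1"
    using assms by auto
  then have "u1 = u2 \<or> u1 = - u2"
    using u1 by (metis scaleR_minus1_left scaleR_one)
  moreover have "range (\<lambda>t. C + t *\<^sub>R (- u2)) = range (\<lambda>t. C + t *\<^sub>R u2)"
  proof -
    have "range (\<lambda>t. C + t *\<^sub>R (- u2)) = (\<lambda>t. C + t *\<^sub>R u2) ` range uminus"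
      unfolding image_image by simp
    then show ?thesis
      by simp
  qed
  ultimately show False
    using assms(3) by metis
qed

text \<open>The sum \<open>d\<close> of the two unit directions is a diagonal of the rhombus that
  they span, so it halves the angle.\<close>

lemma bisector_exists:
  assumes "A \<in> l1" "A \<noteq> C" "B \<in> l2" "B \<noteq> C" and le: "vertex_angle A C B \<le> pi / 2"
  shows "\<exists>m. is_angle_bisector l1 l2 C m"
proof -
  define u1 u2 where "u1 = sgn (A - C)" and "u2 = sgn (B - C)"
  define \<theta> where "\<theta> = vertex_angle A C B"
  define d where "d = u1 + u2"
  have n: "u1 \<bullet> u1 = 1" "u2 \<bullet> u2 = 1"
    using assms by (simp_all add: u1_def u2_def norm_sgn flip: norm_eq_1)
  have k: "cos \<theta> = u1 \<bullet> u2"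
    using assms by (simp add: \<theta>_def u1_def u2_def cos_vertex_angle)
  have \<theta>: "0 \<le> \<theta>" "\<theta> \<le> pi / 2"
    using assms vertex_angle_bounds by (simp_all add: \<theta>_def)
  then have cpos: "0 < cos (\<theta> / 2)"
    using pi_gt_zero by (intro cos_gt_zero_pi) linarith+
  have half: "1 + cos \<theta> = 2 * (cos (\<theta> / 2))\<^sup>2"
    using cos_double_cos[of "\<theta> / 2"] by simp
  have "(norm d)\<^sup>2 = (2 * cos (\<theta> / 2))\<^sup>2"
    using half k n
    by (simp add: d_def power2_norm_eq_inner inner_add inner_commute power_mult_distrib)
  then have nd: "norm d = 2 * cos (\<theta> / 2)"
    by (rule power2_eq_imp_eq) (use cpos in simp_all)
  have "d \<noteq> 0"
    using nd cpos by auto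
  \<comment> \<open>Both inner products with \<open>d\<close> equal 1 + cos \<theta> = 2
    cos^2(\<theta>/2); dividing by the norm 2 cos(\<theta>/2) leaves cos(\<theta>/2).\<close>
  have "u1 \<bullet> sgn d = cos (\<theta> / 2)" "sgn d \<bullet> u2 = cos (\<theta> / 2)"
    using half k n cpos
    by (simp_all add: sgn_div_norm nd d_def[symmetric])
      (simp_all add: d_def inner_add inner_commute field_simps power2_eq_square)
  then have "cos (vertex_angle A C (C + d)) = cos (\<theta> / 2)"
    "cos (vertex_angle (C + d) C B) = cos (\<theta> / 2)"
    using assms \<open>d \<noteq> 0\<close> by (simp_all add: cos_vertex_angle u1_def u2_def)
  \<comment> \<open>With all angles in [0, pi], where the cosine is injective, equal cosines give
    equal angles.\<close>
  moreover have "0 \<le> vertex_angle A C (C + d)" "vertex_angle A C (C + d) \<le> pi"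
    "0 \<le> vertex_angle (C + d) C B" "vertex_angle (C + d) C B \<le> pi"
    using assms \<open>d \<noteq> 0\<close> by (simp_all add: vertex_angle_bounds)
  moreover have "0 \<le> \<theta> / 2" "\<theta> / 2 \<le> pi"
    using \<theta> pi_gt_zero by linarith+
  ultimately have "vertex_angle A C (C + d) = \<theta> / 2" "vertex_angle (C + d) C B = \<theta> / 2"
    by (metis arccos_cos)+
  then have "is_angle_bisector l1 l2 C (affine hull {C, C + d})"
    unfolding is_angle_bisector_def using assms \<open>d \<noteq> 0\<close>
    by (intro bexI[of _ A] bexI[of _ B] exI[of _ "C + d"]) (auto simp: \<theta>_def)
  then show ?thesis ..
qed

section \<open>The ellipse in its principal axes\<close>

lemma affine_hull_2_sgn:
  fixes C D :: "real^2"
  assumes "D \<noteq> C"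
  shows "affine hull {C, D} = affine hull {C, C + sgn (D - C)}"
proof -
  have l: "is_line (affine hull {C, D})"
    using assms by (simp add: is_line_def aff_dim_2)
  have "affine hull {C, D} = range (\<lambda>t. C + t *\<^sub>R sgn (D - C))"
    using assms by (intro line_eq_range_unit[OF l]) (auto simp: hull_inc)
  then show ?thesis
    by (simp add: affine_hull_2_alt)
qed

text \<open>Equal angles of \<open>e1\<close> with \<open>u1\<close> and \<open>u2\<close> make it orthogonal to \<open>u1 - u2\<close>; in the plane this fixes
  the line it spans, the second axis being spanned by \<open>u1 - u2\<close>.\<close>

lemma is_ellipse_bisector:
  fixes u1 u2 e1 C :: "real^2"
  assumes "0 < c" "norm u1 = 1" "norm u2 = 1" "norm e1 = 1"
    and bis: "e1 \<bullet> u1 = e1 \<bullet> u2"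
    and k: "0 \<le> u1 \<bullet> u2" "u1 \<bullet> u2 < 1"
  shows "is_ellipse {P. 2 * (norm (P - C))\<^sup>2 - ((P - C) \<bullet> u1)\<^sup>2 - ((P - C) \<bullet> u2)\<^sup>2 = c} C
    (sqrt c / sqrt (1 - u1 \<bullet> u2)) (sqrt c / sqrt (1 + u1 \<bullet> u2)) (affine hull {C, C + e1})"
proof -
  define k where "k = u1 \<bullet> u2"
  define a b where "a = sqrt c / sqrt (1 - k)" and "b = sqrt c / sqrt (1 + k)"
  define e2 where "e2 = sgn (u1 - u2)"
  have "u1 \<noteq> u2"
    using k assms by (auto simp: norm_eq_1)
  then have n2: "norm e2 = 1"
    by (simp add: e2_def norm_sgn)
  have o: "e1 \<bullet> e2 = 0"
    using bis by (simp add: e2_def sgn_div_norm inner_diff_right)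
  have nn: "u1 \<bullet> u1 = 1" "u2 \<bullet> u2 = 1" "e1 \<bullet> e1 = 1" "e2 \<bullet> e2 = 1"
    using assms n2 by (simp_all add: norm_eq_1)
  define p q where "p = e1 \<bullet> u1" and "q = e2 \<bullet> u1"
  \<comment> \<open>The diagonals \<open>u1 - u2\<close> and \<open>u1 + u2\<close> of a rhombus are
    orthogonal. Hence \<open>u1\<close> and \<open>u2\<close> have opposite coordinates along
    \<open>e2\<close>; by \<open>bis\<close> they have equal ones along \<open>e1\<close>, so they
    are mirror images in that axis.\<close>
  have q2: "e2 \<bullet> u2 = - q"
  proof -
    have "(u1 - u2) \<bullet> (u1 + u2) = 0"
      by (simp add: inner_diff inner_add inner_commute nn)
    then have "e2 \<bullet> (u1 + u2) = 0"
      by (simp add: e2_def sgn_div_norm)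
    then show ?thesis
      by (simp add: q_def inner_add_right)
  qed
  have u1: "u1 = p *\<^sub>R e1 + q *\<^sub>R e2"
    using orthonormal_expansion_2[OF assms(4) n2 o, of u1]
    by (simp add: p_def q_def inner_commute)
  have u2: "u2 = p *\<^sub>R e1 - q *\<^sub>R e2"
    using orthonormal_expansion_2[OF assms(4) n2 o, of u2] q2 bis
    by (simp add: p_def inner_commute)
  have "u1 \<bullet> u1 = p\<^sup>2 + q\<^sup>2"
    using o by (subst (1 2) u1) (simp add: inner_add inner_commute nn power2_eq_square)
  then have pq: "p\<^sup>2 + q\<^sup>2 = 1"
    by (simp add: nn)
  have "u1 \<bullet> u2 = p\<^sup>2 - q\<^sup>2"
    using o by (subst u1, subst u2)
      (simp add: inner_add inner_diff inner_commute nn power2_eq_square)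
  then have pk: "2 * p\<^sup>2 = 1 + k" "2 * q\<^sup>2 = 1 - k"
    using pq by (simp_all add: k_def)
  have k01: "0 \<le> k" "k < 1"
    using k by (simp_all add: k_def)
  \<comment> \<open>The non-obtuse angle enters here: 0 \<le> \<open>k\<close> makes 1 -
    \<open>k\<close> the smaller eigenvalue, so the longer semi-axis lies along
    \<open>e1\<close>.\<close>
  have "0 < b" "b \<le> a"
    using k01 \<open>0 < c\<close> by (auto simp: a_def b_def intro!: divide_left_mono)
  have ab: "x\<^sup>2 / a\<^sup>2 + y\<^sup>2 / b\<^sup>2 = (x\<^sup>2 * (1 - k) + y\<^sup>2 * (1 + k)) / c" for x y
    using k01 \<open>0 < c\<close> by (simp add: a_def b_def power_divide add_divide_distrib)
  \<comment> \<open>The mixed terms in \<open>x * y\<close> cancel because \<open>u1\<close> and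
    \<open>u2\<close> are mirror images; \<open>pk\<close> then turns the coefficients 2 - 2 p^2 and
    2 - 2 q^2 into the eigenvalues.\<close>
  have Q: "2 * (norm w)\<^sup>2 - (w \<bullet> u1)\<^sup>2 - (w \<bullet> u2)\<^sup>2 = x\<^sup>2 * (1 - k) + y\<^sup>2 * (1 + k)"
    if w: "w = x *\<^sub>R e1 + y *\<^sub>R e2" for w x y
  proof -
    have o': "e2 \<bullet> e1 = 0"
      using o by (simp add: inner_commute)
    have "(norm w)\<^sup>2 = x\<^sup>2 + y\<^sup>2"
      unfolding w power2_norm_eq_inner
      using o o' by (simp add: inner_add nn power2_eq_square)
    moreover have wu: "w \<bullet> u1 = x * p + y * q" "w \<bullet> u2 = x * p - y * q"
      using q2 bis by (simp_all add: w inner_add_left p_def q_def)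
    ultimately have "2 * (norm w)\<^sup>2 - (w \<bullet> u1)\<^sup>2 - (w \<bullet> u2)\<^sup>2
        = x\<^sup>2 * (2 - 2 * p\<^sup>2) + y\<^sup>2 * (2 - 2 * q\<^sup>2)"
      unfolding wu by (simp add: power2_eq_square algebra_simps)
    then show ?thesis
      by (simp add: pk)
  qed
  have "{P. 2 * (norm (P - C))\<^sup>2 - ((P - C) \<bullet> u1)\<^sup>2 - ((P - C) \<bullet> u2)\<^sup>2 = c}
    = {C + x *\<^sub>R e1 + y *\<^sub>R e2 | x y. x\<^sup>2 / a\<^sup>2 + y\<^sup>2 / b\<^sup>2 = 1}" (is "?L = ?R")
  proof (intro set_eqI iffI)
    fix P assume P: "P \<in> ?L"
    define x y where "x = (P - C) \<bullet> e1" and "y = (P - C) \<bullet> e2"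
    have w: "P - C = x *\<^sub>R e1 + y *\<^sub>R e2"
      unfolding x_def y_def by (rule orthonormal_expansion_2[OF assms(4) n2 o])
    then have "P = C + x *\<^sub>R e1 + y *\<^sub>R e2"
      by (simp add: algebra_simps)
    moreover have "x\<^sup>2 / a\<^sup>2 + y\<^sup>2 / b\<^sup>2 = 1"
      using P Q[OF w] \<open>0 < c\<close> by (simp add: ab)
    ultimately show "P \<in> ?R"
      by blast
  next
    fix P assume "P \<in> ?R"
    then obtain x y where P: "P = C + x *\<^sub>R e1 + y *\<^sub>R e2" and xy: "x\<^sup>2 / a\<^sup>2 + y\<^sup>2 / b\<^sup>2 = 1"
      by blast
    have w: "P - C = x *\<^sub>R e1 + y *\<^sub>R e2"
      by (simp add: P)
    show "P \<in> ?L"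
      using Q[OF w] xy \<open>0 < c\<close> by (simp add: ab)
  qed
  then show ?thesis
    unfolding is_ellipse_def k_def[symmetric] a_def[symmetric] b_def[symmetric]
    using \<open>0 < b\<close> \<open>b \<le> a\<close> assms(4) n2 o unfolding orthogonal_def by blast
qed

section \<open>Unit normals and the intersections with the eccentrices\<close>

lemma v_euclidean_dist_inner:
  "v_euclidean_dist v1 v2 C P = sqrt ((v1 \<bullet> (P - C))\<^sup>2 + (v2 \<bullet> (P - C))\<^sup>2)"
  by (simp add: v_euclidean_dist_def inner_vec_def sum_2 power2_eq_square algebra_simps)

lemma perpendicular_to_range:
  assumes "perpendicular_to_line v (range (\<lambda>t. C + t *\<^sub>R u))"
  shows "u \<bullet> v = 0"
proof -
  have "orthogonal v ((C + 1 *\<^sub>R u) - (C + 0 *\<^sub>R u))"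
    using assms unfolding perpendicular_to_line_def by blast
  then show ?thesis
    by (simp add: orthogonal_def inner_commute)
qed

text \<open>In the plane the normals of a line form a one-dimensional space. This excludes that
  independent \<open>v1\<close> and \<open>v2\<close> are both perpendicular to the same
  eccentrix.\<close>

lemma not_independent_common_normal:
  fixes u v1 v2 :: "real^2"
  assumes "norm u = 1" "norm v2 = 1" "u \<bullet> v1 = 0" "u \<bullet> v2 = 0" "v1 \<noteq> v2"
  shows "\<not> independent {v1, v2}"
proof -
  have "v1 = (v1 \<bullet> v2) *\<^sub>R v2"
    using orthonormal_expansion_2[of u v2 v1] assms by (simp add: inner_commute)
  then have "v1 \<in> span ({v1, v2} - {v1})"
    using assms(5) by (metis Diff_insert_absorb empty_iff insert_iff span_base span_scale
        insert_Diff_if singletonD singletonI)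
  then show ?thesis
    by (auto simp: dependent_def)
qed

text \<open>It guarantees that the description of the radius by intersection points is not
  vacuous.\<close>

lemma ellipse_meets_eccentrix:
  fixes u1 u2 :: "'a::real_inner"
  assumes "0 < c" "norm u1 = 1" "norm u2 = 1" "(u1 \<bullet> u2)\<^sup>2 < 1"
  shows "range (\<lambda>t. C + t *\<^sub>R u1) \<inter>
    {P. 2 * (norm (P - C))\<^sup>2 - ((P - C) \<bullet> u1)\<^sup>2 - ((P - C) \<bullet> u2)\<^sup>2 = c} \<noteq> {}"
proof -
  \<comment> \<open>At \<open>C + t *\<^sub>R u1\<close> the distance to the first line is zero, and
    the squared distance to the second is
    \<open>t\<^sup>2 * (1 - (u1 \<bullet> u2)\<^sup>2)\<close>. Equating this with \<open>c\<close>
    gives \<open>t\<close>.\<close>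
  define t where "t = sqrt (c / (1 - (u1 \<bullet> u2)\<^sup>2))"
  have "t\<^sup>2 * (1 - (u1 \<bullet> u2)\<^sup>2) = c"
    using assms by (simp add: t_def)
  then have "2 * (norm (t *\<^sub>R u1))\<^sup>2 - ((t *\<^sub>R u1) \<bullet> u1)\<^sup>2 - ((t *\<^sub>R u1) \<bullet> u2)\<^sup>2 = c"
    using assms(2) by (simp add: norm_eq_1 power2_norm_eq_inner power_mult_distrib algebra_simps)
  then have "C + t *\<^sub>R u1 \<in>
      {P. 2 * (norm (P - C))\<^sup>2 - ((P - C) \<bullet> u1)\<^sup>2 - ((P - C) \<bullet> u2)\<^sup>2 = c}"
    by (simp only: mem_Collect_eq add_diff_cancel_left')
  then show ?thesis
    by blast
qed

lemma eccentrix_ellipse_commute: "eccentrix_ellipse c l l' = eccentrix_ellipse c l' l"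
  by (simp add: eccentrix_ellipse_def add.commute)

lemma infdist_other_eccentrix:
  assumes "P \<in> l \<inter> eccentrix_ellipse c l l'"
  shows "sqrt c = infdist P l'"
proof -
  have "infdist P l = 0" "(infdist P l)\<^sup>2 + (infdist P l')\<^sup>2 = c"
    using assms by (auto simp: eccentrix_ellipse_def)
  then show ?thesis
    by (auto simp: infdist_nonneg)
qed

theorem corollary5p1:
  fixes c \<theta> :: real and l1 l2 :: "(real^2) set" and C :: "real^2"
  assumes "c > 0"
    and "is_line l1" and "is_line l2" and "l1 \<noteq> l2"
    and "C \<in> l1" and "C \<in> l2"
    and "nonobtuse_angle_between l1 l2 C \<theta>"
  shows "(\<exists>m. is_angle_bisector l1 l2 C m) \<and>
    (\<forall>m. is_angle_bisector l1 l2 C m \<longrightarrow>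
       is_ellipse (eccentrix_ellipse c l1 l2) C
         (sqrt c / sqrt (1 - cos \<theta>)) (sqrt c / sqrt (1 + cos \<theta>)) m) \<and>
    (\<forall>v1 v2 :: real^2. v1 \<noteq> v2 \<and> independent {v1, v2} \<and> norm v1 = 1 \<and> norm v2 = 1 \<and>
       (perpendicular_to_line v1 l1 \<or> perpendicular_to_line v1 l2) \<and>
       (perpendicular_to_line v2 l1 \<or> perpendicular_to_line v2 l2) \<longrightarrow>
       eccentrix_ellipse c l1 l2 = v_euclidean_circle v1 v2 C (sqrt c)) \<and>
    l1 \<inter> eccentrix_ellipse c l1 l2 \<noteq> {} \<and>
    l2 \<inter> eccentrix_ellipse c l1 l2 \<noteq> {} \<and>
    (\<forall>P \<in> l1 \<inter> eccentrix_ellipse c l1 l2. sqrt c = infdist P l2) \<and>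
    (\<forall>P \<in> l2 \<inter> eccentrix_ellipse c l1 l2. sqrt c = infdist P l1)"
proof -
  from assms(7) obtain A B where AB: "A \<in> l1" "A \<noteq> C" "B \<in> l2" "B \<noteq> C"
    and ang: "vertex_angle A C B = \<theta>" "\<theta> \<le> pi / 2"
    unfolding nonobtuse_angle_between_def by blast
  define u1 u2 where "u1 = sgn (A - C)" and "u2 = sgn (B - C)"
  have n: "norm u1 = 1" "norm u2 = 1"
    using AB by (simp_all add: u1_def u2_def norm_sgn)
  have l1: "l1 = range (\<lambda>t. C + t *\<^sub>R u1)" and l2: "l2 = range (\<lambda>t. C + t *\<^sub>R u2)"
    unfolding u1_def u2_def using assms AB by (intro line_eq_range_unit; simp)+
  have k1: "(u1 \<bullet> u2)\<^sup>2 < 1"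
    using inner_power2_less_1[OF n, of C] assms(4) by (simp add: l1 l2)
  have k: "cos \<theta> = u1 \<bullet> u2"
    using AB by (simp add: u1_def u2_def cos_vertex_angle flip: ang(1))
  have E: "eccentrix_ellipse c l1 l2 =
      {P. 2 * (norm (P - C))\<^sup>2 - ((P - C) \<bullet> u1)\<^sup>2 - ((P - C) \<bullet> u2)\<^sup>2 = c}"
    unfolding eccentrix_ellipse_def l1 l2 infdist_line_power2[OF n(1)] infdist_line_power2[OF n(2)]
    by (simp add: algebra_simps)
  have "is_ellipse (eccentrix_ellipse c l1 l2) C
      (sqrt c / sqrt (1 - cos \<theta>)) (sqrt c / sqrt (1 + cos \<theta>)) m"
    if "is_angle_bisector l1 l2 C m" for m
  proof -
    from that obtain A' B' D where AB': "A' \<in> l1" "A' \<noteq> C" "B' \<in> l2" "B' \<noteq> C" and D: "D \<noteq> C"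
      and ang': "vertex_angle A' C B' \<le> pi / 2"
        "vertex_angle A' C D = vertex_angle A' C B' / 2"
        "vertex_angle D C B' = vertex_angle A' C B' / 2"
      and m: "m = affine hull {C, D}"
      unfolding is_angle_bisector_def by blast
    \<comment> \<open>The bisector comes with its own points on the lines, so \<open>w1\<close> and
      \<open>w2\<close> may differ from \<open>u1\<close> and \<open>u2\<close> in sign.\<close>
    define w1 w2 e1 where "w1 = sgn (A' - C)" and "w2 = sgn (B' - C)" and "e1 = sgn (D - C)"
    have nw: "norm w1 = 1" "norm w2 = 1" "norm e1 = 1"
      using AB' D by (simp_all add: w1_def w2_def e1_def norm_sgn)
    have w: "w1 = u1 \<or> w1 = - u1" "w2 = u2 \<or> w2 = - u2"
      unfolding w1_def w2_def
    using AB' n sgn_diff_on_line[of _ C] l1 l2 by blast+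
    have "0 \<le> cos (vertex_angle A' C B')"
      using ang'(1) vertex_angle_bounds(1)[OF AB'(2,4)] by (intro cos_ge_zero) auto
    then have w0: "0 \<le> w1 \<bullet> w2"
      using AB' by (simp add: w1_def w2_def cos_vertex_angle)
    have "0 \<le> cos \<theta>"
      using ang vertex_angle_bounds(1)[OF AB(2,4)] by (intro cos_ge_zero) auto
    \<comment> \<open>The inner products of the two pairs agree up to sign, and both are nonnegative
      since both angles are non-obtuse. For perpendicular lines both are zero, so either bisector is
      covered.\<close>
    then have wk: "w1 \<bullet> w2 = cos \<theta>"
      using w w0 k by auto
    have "cos (vertex_angle A' C D) = cos (vertex_angle D C B')"
      using ang' by metis
    then have bis: "e1 \<bullet> w1 = e1 \<bullet> w2"
      using AB' D by (simp add: cos_vertex_angle w1_def w2_def e1_def inner_commute)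
    have "w1 \<bullet> w2 < 1"
      using k1 k wk w0 by (simp add: abs_square_less_1)
    then have "is_ellipse {P. 2 * (norm (P - C))\<^sup>2 - ((P - C) \<bullet> w1)\<^sup>2 - ((P - C) \<bullet> w2)\<^sup>2 = c} C
        (sqrt c / sqrt (1 - w1 \<bullet> w2)) (sqrt c / sqrt (1 + w1 \<bullet> w2)) (affine hull {C, C + e1})"
      using is_ellipse_bisector[OF assms(1) nw bis w0] by blast
    moreover have "affine hull {C, C + e1} = m"
      unfolding m e1_def using affine_hull_2_sgn[OF D] by simp
    \<comment> \<open>The quadratic form contains the directions only through squares, so the signs
      disappear.\<close>
    moreover have "(z \<bullet> w1)\<^sup>2 = (z \<bullet> u1)\<^sup>2" "(z \<bullet> w2)\<^sup>2 = (z \<bullet> u2)\<^sup>2" for z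
      using w by auto
    ultimately show ?thesis
      by (simp add: E wk)
  qed
  moreover have "eccentrix_ellipse c l1 l2 = v_euclidean_circle v1 v2 C (sqrt c)"
    if v: "v1 \<noteq> v2" "independent {v1, v2}" "norm v1 = 1" "norm v2 = 1"
      "perpendicular_to_line v1 l1 \<or> perpendicular_to_line v1 l2"
      "perpendicular_to_line v2 l1 \<or> perpendicular_to_line v2 l2" for v1 v2
  proof -
    have "u1 \<bullet> v1 = 0 \<or> u2 \<bullet> v1 = 0" "u1 \<bullet> v2 = 0 \<or> u2 \<bullet> v2 = 0"
      using v(5,6) perpendicular_to_range unfolding l1 l2 by blast+
    \<comment> \<open>Independence rules out a common line, so the two normals belong to different
      eccentrices, in one order or the other.\<close>
    then have "(u1 \<bullet> v1 = 0 \<and> u2 \<bullet> v2 = 0) \<or> (u2 \<bullet> v1 = 0 \<and> u1 \<bullet> v2 = 0)"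
      using not_independent_common_normal v n by blast
    then have "(v1 \<bullet> z)\<^sup>2 + (v2 \<bullet> z)\<^sup>2 = 2 * (norm z)\<^sup>2 - (z \<bullet> u1)\<^sup>2 - (z \<bullet> u2)\<^sup>2" for z
      using inner_normal_power2 v(3,4) n by fastforce
    then show ?thesis
      by (simp add: E v_euclidean_circle_def v_euclidean_dist_inner)
  qed
  moreover have "l1 \<inter> eccentrix_ellipse c l1 l2 \<noteq> {}"
    using ellipse_meets_eccentrix[OF assms(1) n k1, of C] by (simp add: E flip: l1)
  moreover have "l2 \<inter> eccentrix_ellipse c l1 l2 \<noteq> {}"
    using ellipse_meets_eccentrix[OF assms(1) n(2,1), of C] k1
    by (simp add: E inner_commute algebra_simps flip: l2)
  moreover have "\<exists>m. is_angle_bisector l1 l2 C m"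
    using AB ang by (intro bisector_exists[OF AB]) simp
  moreover have "\<forall>P \<in> l1 \<inter> eccentrix_ellipse c l1 l2. sqrt c = infdist P l2"
    using infdist_other_eccentrix by blast
  moreover have "\<forall>P \<in> l2 \<inter> eccentrix_ellipse c l1 l2. sqrt c = infdist P l1"
    using infdist_other_eccentrix[of _ l2 c l1] by (simp add: eccentrix_ellipse_commute[of c l2])
  ultimately show ?thesis
    by blast
qed

end
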